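(* (1) Let $G$ be a group and let $M$ be a monoid HNN-extension of $G$ in which each associated submonoid $H_i$ is in fact a subgroup of $G$. Then $M$ is a left Rees monoid. (2) Conversely, if $M$ is a left Rees monoid, then $M$ is isomorphic to a monoid HNN-extension of a group.
   Context: A monoid $M$ is a left Rees monoid if: (LR1) $M$ is left cancellative; (LR2) $M$ is right rigid, i.e. $aM\cap bM\neq\emptyset$ implies $aM\subseteq bM$ or $bM\subseteq aM$; (LR3) each principal right ideal is properly contained in only finitely many principal right ideals; and, by convention, $M$ is not a group. Monoid HNN-extension: let $S$ be a monoid, $I$ a (non-empty) index set, $H_i$ ($i\in I$) submonoids of $S$ and $\rho_i:H_i\to S$ monoid homomorphisms. With $\breve{S}=S\setminus\{1\}$ and $\mathcal{R}(S)$ the relations of $S$ (its multiplication table), the monoid given by the monoid presentation $$\langle \breve{S},\ t_i\ (i\in I)\ |\ \mathcal{R}(S),\ h t_i=t_i\rho_i(h)\ \ \forall h\in H_i,\ i\in I\rangle$$ is called a monoid HNN-extension of $S$ with associated submonoids $H_i$. *)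

theory Defs
  imports "HOL-Algebra.Coset"
begin

text \<open>The principal right ideal generated by \<open>a\<close> is the coset \<open>a <#\<^bsub>M\<^esub> carrier M\<close>.\<close>

definition left_rees_monoid :: "('a, 'm) monoid_scheme \<Rightarrow> bool" where
  "left_rees_monoid M \<longleftrightarrow>
     monoid M \<and>
     (\<forall>a \<in> carrier M. \<forall>b \<in> carrier M. \<forall>c \<in> carrier M.
        a \<otimes>\<^bsub>M\<^esub> b = a \<otimes>\<^bsub>M\<^esub> c \<longrightarrow> b = c) \<and>
     (\<forall>a \<in> carrier M. \<forall>b \<in> carrier M.
        (a <#\<^bsub>M\<^esub> carrier M) \<inter> (b <#\<^bsub>M\<^esub> carrier M) \<noteq> {} \<longrightarrow>
        a <#\<^bsub>M\<^esub> carrier M \<subseteq> b <#\<^bsub>M\<^esub> carrier M \<or>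
        b <#\<^bsub>M\<^esub> carrier M \<subseteq> a <#\<^bsub>M\<^esub> carrier M) \<and>
     (\<forall>a \<in> carrier M.
        finite {J. (\<exists>b \<in> carrier M. J = b <#\<^bsub>M\<^esub> carrier M) \<and> a <#\<^bsub>M\<^esub> carrier M \<subset> J}) \<and>
     \<not> group M"

text \<open>The free monoid on a set \<open>X\<close> consists of the lists over \<open>X\<close> under concatenation.
  The following is the smallest congruence on it that contains the relations \<open>R\<close>.\<close>

inductive_set presentation_cong :: "'x set \<Rightarrow> ('x list \<times> 'x list) set \<Rightarrow> ('x list \<times> 'x list) set"
  for X :: "'x set" and R :: "('x list \<times> 'x list) set" where
  rel: "(u, v) \<in> R \<Longrightarrow> u \<in> lists X \<Longrightarrow> v \<in> lists X \<Longrightarrow> (u, v) \<in> presentation_cong X R"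
| refl: "u \<in> lists X \<Longrightarrow> (u, u) \<in> presentation_cong X R"
| sym: "(u, v) \<in> presentation_cong X R \<Longrightarrow> (v, u) \<in> presentation_cong X R"
| trans: "(u, v) \<in> presentation_cong X R \<Longrightarrow> (v, w) \<in> presentation_cong X R \<Longrightarrow>
    (u, w) \<in> presentation_cong X R"
| append: "(u, v) \<in> presentation_cong X R \<Longrightarrow> (u', v') \<in> presentation_cong X R \<Longrightarrow>
    (u @ u', v @ v') \<in> presentation_cong X R"

definition presented_monoid :: "'x set \<Rightarrow> ('x list \<times> 'x list) set \<Rightarrow> 'x list set monoid" where
  "presented_monoid X R =
     \<lparr>carrier = lists X // presentation_cong X R,
      mult = (\<lambda>A B. \<Union>u\<in>A. \<Union>v\<in>B. presentation_cong X R `` {u @ v}),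
      one = presentation_cong X R `` {[]}\<rparr>"

lemma presentation_cong_in_lists:
  "(u, v) \<in> presentation_cong X R \<Longrightarrow> u \<in> lists X \<and> v \<in> lists X"
  by (induction rule: presentation_cong.induct) auto

lemma equiv_presentation_cong: "equiv (lists X) (presentation_cong X R)"
proof (rule equivI)
  show "presentation_cong X R \<subseteq> lists X \<times> lists X"
    using presentation_cong_in_lists[of _ _ X R] by auto
  show "refl_on (lists X) (presentation_cong X R)"
    by (rule refl_onI) (rule presentation_cong.refl)
  show "sym_on UNIV (presentation_cong X R)"
    by (rule symI) (rule presentation_cong.sym)
  show "trans_on UNIV (presentation_cong X R)"
    by (rule transI) (rule presentation_cong.trans)
qed

lemma presented_monoid_mult_class:
  assumes "u \<in> lists X" "v \<in> lists X"
  shows "(presentation_cong X R `` {u}) \<otimes>\<^bsub>presented_monoid X R\<^esub> (presentation_cong X R `` {v}) =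
    presentation_cong X R `` {u @ v}"
proof -
  have "congruent2 (presentation_cong X R) (presentation_cong X R)
      (\<lambda>u v. presentation_cong X R `` {u @ v})"
    unfolding congruent2_def
    by (auto intro!: equiv_class_eq[OF equiv_presentation_cong] presentation_cong.append)
  then show ?thesis
    using UN_equiv_class2[OF equiv_presentation_cong equiv_presentation_cong _ assms]
    by (simp add: presented_monoid_def)
qed

lemma monoid_presented_monoid: "monoid (presented_monoid X R)"
proof -
  let ?P = "presented_monoid X R"
  define L where "L = lists X"
  define c where "c = (\<lambda>u. presentation_cong X R `` {u})"
  have carr: "carrier ?P = c ` L"
    by (auto simp: presented_monoid_def quotient_def c_def L_def)
  have one: "\<one>\<^bsub>?P\<^esub> = c []" by (simp add: presented_monoid_def c_def)
  have nil: "[] \<in> L" by (simp add: L_def)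
  have app: "u @ v \<in> L" if "u \<in> L" "v \<in> L" for u v
    using that by (simp add: L_def)
  have mult: "c u \<otimes>\<^bsub>?P\<^esub> c v = c (u @ v)" if "u \<in> L" "v \<in> L" for u v
    using that presented_monoid_mult_class[of u X v R] by (simp add: L_def c_def)
  show ?thesis
    by (rule monoidI) (auto simp: carr one mult app nil)
qed

text \<open>\<^const>\<open>hom\<close> only asks for multiplicativity, so preservation of the identity is
  required separately.\<close>

locale monoid_hnn_data = monoid S for S :: "('a, 'm) monoid_scheme" (structure) +
  fixes I :: "'i set" and H :: "'i \<Rightarrow> 'a set" and \<rho> :: "'i \<Rightarrow> 'a \<Rightarrow> 'a"
  assumes I_nonempty: "I \<noteq> {}"
    and H_submonoid: "i \<in> I \<Longrightarrow> submonoid (H i) S"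
    and \<rho>_hom: "i \<in> I \<Longrightarrow> \<rho> i \<in> hom (S\<lparr>carrier := H i\<rparr>) S"
    and \<rho>_one: "i \<in> I \<Longrightarrow> \<rho> i \<one> = \<one>"

text \<open>Generators are \<open>Inl s\<close> for \<open>s \<noteq> \<one>\<close> and \<open>Inr i\<close> for the stable letter \<open>t\<^sub>i\<close>; the identity
  of \<open>S\<close> is not a generator, and is represented by the empty word.\<close>

definition hnn_word :: "('a, 'm) monoid_scheme \<Rightarrow> 'a \<Rightarrow> ('a + 'i) list" where
  "hnn_word S s = (if s = \<one>\<^bsub>S\<^esub> then [] else [Inl s])"

definition hnn_generators :: "('a, 'm) monoid_scheme \<Rightarrow> 'i set \<Rightarrow> ('a + 'i) set" where
  "hnn_generators S I = Inl ` (carrier S - {\<one>\<^bsub>S\<^esub>}) \<union> Inr ` I"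

definition hnn_relations :: "('a, 'm) monoid_scheme \<Rightarrow> 'i set \<Rightarrow> ('i \<Rightarrow> 'a set) \<Rightarrow>
    ('i \<Rightarrow> 'a \<Rightarrow> 'a) \<Rightarrow> (('a + 'i) list \<times> ('a + 'i) list) set" where
  "hnn_relations S I H \<rho> =
     {([Inl a, Inl b], hnn_word S (a \<otimes>\<^bsub>S\<^esub> b)) | a b.
        a \<in> carrier S - {\<one>\<^bsub>S\<^esub>} \<and> b \<in> carrier S - {\<one>\<^bsub>S\<^esub>}} \<union>
     {(hnn_word S h @ [Inr i], [Inr i] @ hnn_word S (\<rho> i h)) | h i. i \<in> I \<and> h \<in> H i}"

definition hnn_extension :: "('a, 'm) monoid_scheme \<Rightarrow> 'i set \<Rightarrow> ('i \<Rightarrow> 'a set) \<Rightarrow>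
    ('i \<Rightarrow> 'a \<Rightarrow> 'a) \<Rightarrow> ('a + 'i) list set monoid" where
  "hnn_extension S I H \<rho> = presented_monoid (hnn_generators S I) (hnn_relations S I H \<rho>)"

end

theory Submission
  imports Defs "HOL-Algebra.Divisibility"
begin

text \<open>Call \<open>g \<cdot> t\<^sub>i\<close>, with \<open>g\<close> in the base group, a syllable. Every element of an HNN-extension is
  either a base element or a syllable times a remainder (\<open>HNN_induct\<close>). Both halves of the theorem
  rest on the extent to which the first syllable is determined by the element.

  For a base group with associated subgroups the answer is \<open>syllable_eqD\<close>:
  \<open>g \<cdot> t\<^sub>i \<cdot> m = h \<cdot> t\<^sub>j \<cdot> n\<close> forces \<open>i = j\<close>, \<open>k = h\<inverse>g \<in> H\<^sub>i\<close> and \<open>\<rho>\<^sub>i(k) \<cdot> m = n\<close>, so that the two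
  factorizations differ only by moving \<open>k\<close> across \<open>t\<^sub>i\<close>; and a product that starts with a syllable
  is never a base element (\<open>base_neq_syllable\<close>). This replaces a normal form theorem and is proved
  without choosing coset representatives: the condition on the right, read as a relation between
  words, is preserved by every rule that generates the defining congruence
  (\<open>same_syllable_presentation_cong\<close>). Since the remainders \<open>m\<close>, \<open>n\<close> enter it only through their
  classes in the HNN-extension itself, no recursion over syllables is involved. Cancellativity,
  rigidity and finiteness then follow by induction on the number of syllables, base elements being
  units: two elements with a common right multiple either include a unit or share their first
  syllable, which can be stripped off.

  Conversely, let \<open>M\<close> be a left Rees monoid. The base group is the group of units, and the stable
  letters are representatives of the double cosets of irreducible elements under left and right
  multiplication by units. The associated subgroup of \<open>t\<close> consists of the units \<open>g\<close> with
  \<open>g \<otimes> t = t \<otimes> k\<close> for some unit \<open>k\<close>, which is unique by cancellation; \<open>g \<mapsto> k\<close> is the homomorphism.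
  Counting the principal right ideals above an element shows that units and irreducibles generate
  \<open>M\<close> (\<open>factorization_induct\<close>), so the canonical map from the HNN-extension is onto. Rigidity makes
  irreducibles with a common right multiple equal up to a unit on the right, so \<open>M\<close> satisfies
  the analogue of \<open>syllable_eqD\<close> (\<open>syllables_meet\<close>), and comparing syllable by syllable shows that
  the map is injective.\<close>

section \<open>The universal property of a presented monoid\<close>

primrec word_value :: "('a, 'm) monoid_scheme \<Rightarrow> ('x \<Rightarrow> 'a) \<Rightarrow> 'x list \<Rightarrow> 'a" where
  "word_value M f [] = \<one>\<^bsub>M\<^esub>"
| "word_value M f (x # w) = f x \<otimes>\<^bsub>M\<^esub> word_value M f w"

context monoid
begin

lemma word_value_closed:
  assumes "f \<in> X \<rightarrow> carrier G" "w \<in> lists X"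
  shows "word_value G f w \<in> carrier G"
  using assms(2) by induction (use assms(1) in auto)

lemma word_value_append:
  assumes "f \<in> X \<rightarrow> carrier G" "u \<in> lists X" "v \<in> lists X"
  shows "word_value G f (u @ v) = word_value G f u \<otimes> word_value G f v"
  using assms(2)
proof induction
  case Nil
  then show ?case using word_value_closed[OF assms(1,3)] by simp
next
  case (Cons x u)
  then show ?case
    using word_value_closed[OF assms(1)] assms by (auto simp: m_assoc Pi_iff)
qed

lemma word_value_presentation_cong:
  assumes f: "f \<in> X \<rightarrow> carrier G"
    and R: "\<And>u v. (u, v) \<in> R \<Longrightarrow> word_value G f u = word_value G f v"
    and uv: "(u, v) \<in> presentation_cong X R"
  shows "word_value G f u = word_value G f v"
  using uv
proof induction
  case (append u v u' v')
  then show ?case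
    using presentation_cong_in_lists[of _ _ X R] word_value_append[OF f] by metis
qed (auto simp: R)

lemma presented_monoid_lift:
  assumes f: "f \<in> X \<rightarrow> carrier G"
    and R: "\<And>u v. (u, v) \<in> R \<Longrightarrow> word_value G f u = word_value G f v"
  obtains \<phi> where "\<phi> \<in> hom (presented_monoid X R) G"
    and "\<And>w. w \<in> lists X \<Longrightarrow> \<phi> (presentation_cong X R `` {w}) = word_value G f w"
proof
  define \<phi> where "\<phi> A = word_value G f (SOME w. w \<in> A)" for A
  show \<phi>: "\<phi> (presentation_cong X R `` {w}) = word_value G f w" if "w \<in> lists X" for w
  proof -
    have "w \<in> presentation_cong X R `` {w}"
      using that by (simp add: presentation_cong.refl)
    then have "(w, SOME v. v \<in> presentation_cong X R `` {w}) \<in> presentation_cong X R"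
      by (metis Image_singleton_iff someI)
    then show ?thesis
      unfolding \<phi>_def using word_value_presentation_cong[OF f R] by metis
  qed
  show "\<phi> \<in> hom (presented_monoid X R) G"
  proof (rule homI)
    fix A assume "A \<in> carrier (presented_monoid X R)"
    then obtain u where "u \<in> lists X" "A = presentation_cong X R `` {u}"
      by (auto simp: presented_monoid_def elim!: quotientE)
    then show "\<phi> A \<in> carrier G"
      using \<phi> word_value_closed[OF f] by simp
  next
    fix A B
    assume "A \<in> carrier (presented_monoid X R)" "B \<in> carrier (presented_monoid X R)"
    then obtain u v where "u \<in> lists X" "A = presentation_cong X R `` {u}"
      "v \<in> lists X" "B = presentation_cong X R `` {v}"
      by (auto simp: presented_monoid_def elim!: quotientE)
    then show "\<phi> (A \<otimes>\<^bsub>presented_monoid X R\<^esub> B) = \<phi> A \<otimes> \<phi> B"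
      using \<phi> word_value_append[OF f] by (simp add: presented_monoid_mult_class)
  qed
qed

end


section \<open>Principal right ideals and divisibility\<close>

abbreviation right_ideal :: "('a, 'm) monoid_scheme \<Rightarrow> 'a \<Rightarrow> 'a set" where
  "right_ideal M a \<equiv> l_coset M a (carrier M)"

text \<open>The ideal of \<open>a\<close> itself is counted as well; this does not affect finiteness, and it makes
  membership a matter of divisibility instead of proper divisibility.\<close>

definition right_ideals_above :: "('a, 'm) monoid_scheme \<Rightarrow> 'a \<Rightarrow> 'a set set" where
  "right_ideals_above M a =
     {right_ideal M b | b. b \<in> carrier M \<and> b divides\<^bsub>M\<^esub> a}"

context monoid
begin

text \<open>In a non-commutative monoid \<open>divides\<close> refers to left factors, which is why it matches principal
  right ideals.\<close>

lemma mem_right_ideal_iff: "x \<in> right_ideal G a \<longleftrightarrow> a divides x"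
  by (auto simp: l_coset_def factor_def)

lemma right_ideal_subset_iff:
  assumes "a \<in> carrier G" "b \<in> carrier G"
  shows "right_ideal G a \<subseteq> right_ideal G b \<longleftrightarrow> b divides a"
  using assms divides_trans[of b a] divides_refl[of a] mem_right_ideal_iff by blast

lemma right_ideal_eq_carrier:
  assumes "a \<in> carrier G" "\<And>x. x \<in> carrier G \<Longrightarrow> a divides x"
  shows "right_ideal G a = carrier G"
proof
  show "right_ideal G a \<subseteq> carrier G" using assms(1) by (auto simp: l_coset_def)
  show "carrier G \<subseteq> right_ideal G a" using assms(2) by (auto simp: mem_right_ideal_iff)
qed

lemma right_ideal_mult:
  assumes "a \<in> carrier G" "b \<in> carrier G"
  shows "right_ideal G (a \<otimes> b) = l_coset G a (right_ideal G b)"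
  using assms by (auto simp: l_coset_def m_assoc)

lemma right_ideals_meet_iff:
  "(right_ideal G a) \<inter> (right_ideal G b) \<noteq> {} \<longleftrightarrow>
    (\<exists>p \<in> carrier G. \<exists>q \<in> carrier G. a \<otimes> p = b \<otimes> q)"
  by (auto simp: l_coset_def)

lemma right_ideals_above_eq:
  assumes "a \<in> carrier G"
  shows "right_ideals_above G a = insert (right_ideal G a)
    {J. (\<exists>b \<in> carrier G. J = right_ideal G b) \<and> right_ideal G a \<subset> J}"
  using assms right_ideal_subset_iff[OF assms]
  unfolding right_ideals_above_def by blast

text \<open>Both halves of the theorem work with elements and \<open>divides\<close> instead of ideals.\<close>

lemma left_rees_monoid_iff:
  "left_rees_monoid G \<longleftrightarrow>
     (\<forall>a \<in> carrier G. \<forall>b \<in> carrier G. \<forall>c \<in> carrier G. a \<otimes> b = a \<otimes> c \<longrightarrow> b = c) \<and>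
     (\<forall>a \<in> carrier G. \<forall>b \<in> carrier G. \<forall>p \<in> carrier G. \<forall>q \<in> carrier G.
        a \<otimes> p = b \<otimes> q \<longrightarrow> a divides b \<or> b divides a) \<and>
     (\<forall>a \<in> carrier G. finite (right_ideals_above G a)) \<and>
     \<not> group G"
proof -
  have "(\<forall>a \<in> carrier G. \<forall>b \<in> carrier G.
        (right_ideal G a) \<inter> (right_ideal G b) \<noteq> {} \<longrightarrow>
        right_ideal G a \<subseteq> right_ideal G b \<or> right_ideal G b \<subseteq> right_ideal G a) \<longleftrightarrow>
      (\<forall>a \<in> carrier G. \<forall>b \<in> carrier G. \<forall>p \<in> carrier G. \<forall>q \<in> carrier G.
        a \<otimes> p = b \<otimes> q \<longrightarrow> a divides b \<or> b divides a)"
    unfolding right_ideals_meet_iff using right_ideal_subset_iff by metis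
  moreover have "(\<forall>a \<in> carrier G.
        finite {J. (\<exists>b \<in> carrier G. J = right_ideal G b) \<and> right_ideal G a \<subset> J}) \<longleftrightarrow>
      (\<forall>a \<in> carrier G. finite (right_ideals_above G a))"
    by (simp add: right_ideals_above_eq)
  ultimately show ?thesis
    unfolding left_rees_monoid_def using monoid_axioms by simp
qed

end


section \<open>Syllables in a monoid HNN-extension\<close>

context monoid_hnn_data
begin

abbreviation HNN :: "('a + 'i) list set monoid" where
  "HNN \<equiv> hnn_extension S I H \<rho>"

abbreviation hnn_mult (infixl "\<cdot>" 70) where
  "x \<cdot> y \<equiv> x \<otimes>\<^bsub>HNN\<^esub> y"

abbreviation words :: "('a + 'i) list set" where
  "words \<equiv> lists (hnn_generators S I)"

definition word_class :: "('a + 'i) list \<Rightarrow> ('a + 'i) list set" where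
  "word_class w = presentation_cong (hnn_generators S I) (hnn_relations S I H \<rho>) `` {w}"

definition base :: "'a \<Rightarrow> ('a + 'i) list set" where
  "base s = word_class (hnn_word S s)"

definition stable_letter :: "'i \<Rightarrow> ('a + 'i) list set" where
  "stable_letter i = word_class [Inr i]"

sublocale HNN: monoid HNN
  unfolding hnn_extension_def by (rule monoid_presented_monoid)

lemma word_class_closed [simp]: "w \<in> words \<Longrightarrow> word_class w \<in> carrier HNN"
  by (auto simp: word_class_def hnn_extension_def presented_monoid_def intro: quotientI)

lemma HNN_elem_word:
  assumes "x \<in> carrier HNN"
  obtains w where "w \<in> words" "x = word_class w"
  using assms by (auto simp: word_class_def hnn_extension_def presented_monoid_def elim!: quotientE)

lemma word_class_append:
  "u \<in> words \<Longrightarrow> v \<in> words \<Longrightarrow> word_class (u @ v) = word_class u \<cdot> word_class v"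
  by (simp add: word_class_def hnn_extension_def presented_monoid_mult_class)

lemma word_class_Nil: "word_class [] = \<one>\<^bsub>HNN\<^esub>"
  by (simp add: word_class_def hnn_extension_def presented_monoid_def)

lemma word_class_eq_iff:
  assumes "u \<in> words" "v \<in> words"
  shows "word_class u = word_class v \<longleftrightarrow>
    (u, v) \<in> presentation_cong (hnn_generators S I) (hnn_relations S I H \<rho>)"
  unfolding word_class_def using eq_equiv_class_iff[OF equiv_presentation_cong assms] .

lemma hnn_word_words [simp]: "s \<in> carrier S \<Longrightarrow> hnn_word S s \<in> words"
  by (auto simp: hnn_word_def hnn_generators_def)

lemma Inr_words [simp]: "i \<in> I \<Longrightarrow> Inr i \<in> hnn_generators S I"
  by (auto simp: hnn_generators_def)

lemma base_closed [simp]: "s \<in> carrier S \<Longrightarrow> base s \<in> carrier HNN"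
  by (simp add: base_def)

lemma stable_letter_closed [simp]: "i \<in> I \<Longrightarrow> stable_letter i \<in> carrier HNN"
  by (simp add: stable_letter_def)

lemma base_one [simp]: "base \<one> = \<one>\<^bsub>HNN\<^esub>"
  by (simp add: base_def hnn_word_def word_class_Nil)

lemma H_carrier: "i \<in> I \<Longrightarrow> h \<in> H i \<Longrightarrow> h \<in> carrier S"
  using H_submonoid submonoid.subset by blast

lemma \<rho>_closed: "i \<in> I \<Longrightarrow> h \<in> H i \<Longrightarrow> \<rho> i h \<in> carrier S"
  using \<rho>_hom[of i] by (auto simp: hom_def)

lemma \<rho>_mult: "i \<in> I \<Longrightarrow> h \<in> H i \<Longrightarrow> k \<in> H i \<Longrightarrow> \<rho> i (h \<otimes> k) = \<rho> i h \<otimes> \<rho> i k"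
  using \<rho>_hom[of i] by (auto simp: hom_def)

lemma base_mult:
  assumes a: "a \<in> carrier S" and b: "b \<in> carrier S"
  shows "base (a \<otimes> b) = base a \<cdot> base b"
proof (cases "a = \<one> \<or> b = \<one>")
  case True
  then show ?thesis using a b by auto
next
  case False
  then have "([Inl a, Inl b], hnn_word S (a \<otimes> b)) \<in> hnn_relations S I H \<rho>"
    using a b by (auto simp: hnn_relations_def)
  moreover have ab: "[Inl a, Inl b] \<in> words"
    using False a b by (simp add: hnn_generators_def)
  ultimately have "base (a \<otimes> b) = word_class ([Inl a] @ [Inl b])"
    using hnn_word_words[of "a \<otimes> b"] a b
    by (simp add: base_def word_class_eq_iff presentation_cong.rel presentation_cong.sym)
  also have "\<dots> = word_class [Inl a] \<cdot> word_class [Inl b]"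
    using ab by (intro word_class_append) auto
  finally show ?thesis using False by (simp add: base_def hnn_word_def)
qed

lemma base_stable_letter:
  assumes i: "i \<in> I" and h: "h \<in> H i"
  shows "base h \<cdot> stable_letter i = stable_letter i \<cdot> base (\<rho> i h)"
proof -
  have W: "hnn_word S h \<in> words" "hnn_word S (\<rho> i h) \<in> words" "[Inr i] \<in> words"
    using H_carrier[OF i h] \<rho>_closed[OF i h] i by auto
  have "(hnn_word S h @ [Inr i], [Inr i] @ hnn_word S (\<rho> i h)) \<in> hnn_relations S I H \<rho>"
    using i h by (auto simp: hnn_relations_def)
  then have "word_class (hnn_word S h @ [Inr i]) = word_class ([Inr i] @ hnn_word S (\<rho> i h))"
    using W by (subst word_class_eq_iff) (auto intro!: presentation_cong.rel)
  then show ?thesis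
    using W by (simp only: word_class_append base_def stable_letter_def)
qed

text \<open>Letters of the base monoid are multiplied together and absorbed to the left of the next stable
  letter, so every element is a finite sequence of syllables followed by a base element.\<close>

lemma HNN_induct [consumes 1, case_names base syllable]:
  assumes x: "x \<in> carrier HNN"
    and base_case: "\<And>g. g \<in> carrier S \<Longrightarrow> Q (base g)"
    and syllable: "\<And>g i m. g \<in> carrier S \<Longrightarrow> i \<in> I \<Longrightarrow> m \<in> carrier HNN \<Longrightarrow> Q m \<Longrightarrow>
      Q (base g \<cdot> stable_letter i \<cdot> m)"
  shows "Q x"
proof -
  obtain w where w: "w \<in> words" "x = word_class w" using x by (rule HNN_elem_word)
  \<comment> \<open>A further letter from the base monoid is absorbed into the first syllable, so the
    induction on words must range over all such left multiples.\<close>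
  have "\<forall>a \<in> carrier S. Q (base a \<cdot> word_class w)" if "w \<in> words" for w
    using that
  proof induction
    case Nil
    then show ?case by (simp add: word_class_Nil base_case)
  next
    case (Cons y w)
    have yw: "word_class (y # w) = word_class [y] \<cdot> word_class w"
      using word_class_append[of "[y]" w] Cons by simp
    have w: "word_class w \<in> carrier HNN" using Cons by simp
    show ?case
    proof
      fix a assume a: "a \<in> carrier S"
      show "Q (base a \<cdot> word_class (y # w))"
      proof (cases y)
        case (Inl b)
        then have b: "b \<in> carrier S" "b \<noteq> \<one>" using Cons(1) by (auto simp: hnn_generators_def)
        then have "word_class [y] = base b" by (simp add: base_def hnn_word_def Inl)
        then have "base a \<cdot> word_class (y # w) = base (a \<otimes> b) \<cdot> word_class w"
          using a b w by (simp add: yw base_mult HNN.m_assoc)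
        then show ?thesis using Cons(3) a b by simp
      next
        case (Inr i)
        then have i: "i \<in> I" using Cons(1) by (auto simp: hnn_generators_def)
        have "base a \<cdot> word_class (y # w) = base a \<cdot> stable_letter i \<cdot> word_class w"
          using a i w by (simp add: yw[unfolded Inr] Inr HNN.m_assoc flip: stable_letter_def)
        moreover have "Q (word_class w)"
          using bspec[OF Cons(3) one_closed] w by simp
        ultimately show ?thesis using syllable[OF a i w] by simp
      qed
    qed
  qed
  from bspec[OF this[OF w(1)] one_closed] show ?thesis using w x by simp
qed

lemma HNN_cases:
  assumes "x \<in> carrier HNN"
  obtains (base) g where "g \<in> carrier S" "x = base g"
  | (syllable) g i m where "g \<in> carrier S" "i \<in> I" "m \<in> carrier HNN"
      "x = base g \<cdot> stable_letter i \<cdot> m"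
  using assms by (induction rule: HNN_induct) blast+

text \<open>Reading a word up to its first stable letter: \<open>lead\<close> is the product of the base letters before it,
  and \<open>rest\<close> gives that stable letter with the word after it. A word without stable letters has
  \<open>rest\<close> equal to \<open>None\<close>, and then \<open>lead\<close> is its value in the base monoid.\<close>

fun lead :: "('a + 'i) list \<Rightarrow> 'a" where
  "lead [] = \<one>"
| "lead (Inl a # w) = a \<otimes> lead w"
| "lead (Inr i # w) = \<one>"

fun rest :: "('a + 'i) list \<Rightarrow> ('i \<times> ('a + 'i) list) option" where
  "rest [] = None"
| "rest (Inl a # w) = rest w"
| "rest (Inr i # w) = Some (i, w)"

lemma lead_closed [simp]: "w \<in> words \<Longrightarrow> lead w \<in> carrier S"
  by (induction w rule: lead.induct) (auto simp: hnn_generators_def)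

lemma rest_words: "w \<in> words \<Longrightarrow> rest w = Some (i, v) \<Longrightarrow> i \<in> I \<and> v \<in> words"
  by (induction w rule: lead.induct) (auto simp: hnn_generators_def)

lemma lead_append:
  "u \<in> words \<Longrightarrow> v \<in> words \<Longrightarrow>
    lead (u @ v) = (if rest u = None then lead u \<otimes> lead v else lead u)"
proof (induction u rule: lead.induct)
  case 1
  then show ?case by simp
next
  case (2 a u)
  then have au: "a \<in> carrier S" "u \<in> words" by (auto simp: hnn_generators_def)
  then have "lead (u @ v) = (if rest u = None then lead u \<otimes> lead v else lead u)"
    using 2 by blast
  then show ?case
    using m_assoc[OF au(1) lead_closed[OF au(2)] lead_closed[OF 2(3)]] by (cases "rest u") simp_all
next
  case (3 i u)
  then show ?case by simp
qed

lemma rest_append: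
  "rest (u @ v) = (case rest u of None \<Rightarrow> rest v | Some (i, w) \<Rightarrow> Some (i, w @ v))"
  by (induction u rule: rest.induct) auto

lemma lead_rest_hnn_word [simp]:
  "s \<in> carrier S \<Longrightarrow> lead (hnn_word S s) = s" "rest (hnn_word S s) = None"
  by (auto simp: hnn_word_def)

end

section \<open>First syllables over a base group\<close>

locale group_hnn_data = monoid_hnn_data S I H \<rho> + group S
  for S :: "('a, 'm) monoid_scheme" (structure) and I :: "'i set" and H and \<rho> +
  assumes H_subgroup: "i \<in> I \<Longrightarrow> subgroup (H i) S"
begin

text \<open>The two words agree in their first syllable up to moving an element of the associated subgroup
  across the stable letter. The remainders are compared as elements of the HNN-extension, so the
  relation is already defined through the congruence that it is meant to control.\<close>

definition same_syllable :: "('a + 'i) list \<Rightarrow> ('a + 'i) list \<Rightarrow> bool" where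
  "same_syllable u v \<longleftrightarrow>
    (case (rest u, rest v) of
       (None, None) \<Rightarrow> lead u = lead v
     | (Some (i, w), Some (j, z)) \<Rightarrow>
         i = j \<and> inv (lead v) \<otimes> lead u \<in> H i \<and>
         base (\<rho> i (inv (lead v) \<otimes> lead u)) \<cdot> word_class w = word_class z
     | _ \<Rightarrow> False)"

lemma H_inv: "i \<in> I \<Longrightarrow> h \<in> H i \<Longrightarrow> inv h \<in> H i"
  by (rule subgroup.m_inv_closed[OF H_subgroup])

lemma H_mult: "i \<in> I \<Longrightarrow> h \<in> H i \<Longrightarrow> k \<in> H i \<Longrightarrow> h \<otimes> k \<in> H i"
  by (rule subgroup.m_closed[OF H_subgroup])

lemma H_one: "i \<in> I \<Longrightarrow> \<one> \<in> H i"
  by (rule subgroup.one_closed[OF H_subgroup])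

lemma inv_mult_cancel:
  "a \<in> carrier S \<Longrightarrow> g \<in> carrier S \<Longrightarrow> inv a \<otimes> (a \<otimes> g) = g"
  "a \<in> carrier S \<Longrightarrow> g \<in> carrier S \<Longrightarrow> a \<otimes> (inv a \<otimes> g) = g"
  by (simp_all flip: m_assoc)

lemma inv_mult_left_multiple:
  "a \<in> carrier S \<Longrightarrow> g \<in> carrier S \<Longrightarrow> h \<in> carrier S \<Longrightarrow>
    inv (a \<otimes> h) \<otimes> (a \<otimes> g) = inv h \<otimes> g"
  by (simp add: inv_mult_group m_assoc inv_mult_cancel)

lemma base_inv_mult [simp]: "g \<in> carrier S \<Longrightarrow> base (inv g) \<cdot> base g = \<one>\<^bsub>HNN\<^esub>"
  by (simp flip: base_mult)

lemma base_mult_inv [simp]: "g \<in> carrier S \<Longrightarrow> base g \<cdot> base (inv g) = \<one>\<^bsub>HNN\<^esub>"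
  by (simp flip: base_mult)

lemma base_Units: "g \<in> carrier S \<Longrightarrow> base g \<in> Units HNN"
  unfolding Units_def by (auto intro!: bexI[of _ "base (inv g)"])

lemma same_syllable_sym:
  assumes "u \<in> words" "v \<in> words" "same_syllable u v"
  shows "same_syllable v u"
proof (cases "rest u")
  case None
  then show ?thesis using assms(3) by (auto simp: same_syllable_def split: option.splits)
next
  case (Some iw)
  obtain i w where u: "rest u = Some (i, w)" using Some by (cases iw) auto
  then obtain z where v: "rest v = Some (i, z)"
    and k: "inv (lead v) \<otimes> lead u \<in> H i"
    and z: "base (\<rho> i (inv (lead v) \<otimes> lead u)) \<cdot> word_class w = word_class z"
    using assms(3) by (auto simp: same_syllable_def split: option.splits)
  have i: "i \<in> I" "w \<in> words" using rest_words[OF assms(1) u] by auto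
  let ?k = "inv (lead v) \<otimes> lead u"
  have k': "inv (lead u) \<otimes> lead v = inv ?k"
    using assms by (simp add: inv_mult_group)
  have kc: "?k \<in> carrier S" using assms by simp
  have "base (\<rho> i (inv ?k)) \<cdot> word_class z = base (\<rho> i (inv ?k) \<otimes> \<rho> i ?k) \<cdot> word_class w"
    unfolding z[symmetric] using i k H_inv[OF i(1) k] \<rho>_closed[OF i(1)]
    by (simp add: base_mult HNN.m_assoc)
  also have "\<rho> i (inv ?k) \<otimes> \<rho> i ?k = \<one>"
    using \<rho>_mult[OF i(1) H_inv[OF i(1) k] k] kc \<rho>_one[OF i(1)] by simp
  finally show ?thesis
    using u v H_inv[OF i(1) k] k' i by (simp add: same_syllable_def)
qed

lemma same_syllable_trans:
  assumes "u \<in> words" "v \<in> words" "x \<in> words" "same_syllable u v" "same_syllable v x"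
  shows "same_syllable u x"
proof (cases "rest u")
  case None
  then show ?thesis using assms(4,5) by (auto simp: same_syllable_def split: option.splits)
next
  case (Some iw)
  obtain i w where u: "rest u = Some (i, w)" using Some by (cases iw) auto
  then obtain z where v: "rest v = Some (i, z)"
    and k: "inv (lead v) \<otimes> lead u \<in> H i"
    and z: "base (\<rho> i (inv (lead v) \<otimes> lead u)) \<cdot> word_class w = word_class z"
    using assms(4) by (auto simp: same_syllable_def split: option.splits)
  then obtain y where x: "rest x = Some (i, y)"
    and l: "inv (lead x) \<otimes> lead v \<in> H i"
    and y: "base (\<rho> i (inv (lead x) \<otimes> lead v)) \<cdot> word_class z = word_class y"
    using assms(5) by (auto simp: same_syllable_def split: option.splits)
  have i: "i \<in> I" "w \<in> words" using rest_words[OF assms(1) u] by auto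
  let ?k = "inv (lead v) \<otimes> lead u" and ?l = "inv (lead x) \<otimes> lead v"
  have lk: "inv (lead x) \<otimes> lead u = ?l \<otimes> ?k"
    using assms by (simp add: m_assoc inv_mult_cancel)
  have "base (\<rho> i (?l \<otimes> ?k)) \<cdot> word_class w = word_class y"
    unfolding y[symmetric] z[symmetric] using i k l \<rho>_closed[OF i(1)]
    by (simp add: \<rho>_mult base_mult HNN.m_assoc)
  then show ?thesis
    using u x H_mult[OF i(1) l k] lk by (simp add: same_syllable_def)
qed

text \<open>If \<open>u\<close> contains a stable letter, then \<open>u'\<close> and \<open>v'\<close> only extend the remainders, where it suffices
  that they have the same class. Otherwise their own first syllables matter, multiplied on the left
  by the common value of \<open>u\<close> and \<open>v\<close>; this value cancels in \<open>inv (lead v) \<otimes> lead u\<close>.\<close>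

lemma same_syllable_append:
  assumes W: "u \<in> words" "v \<in> words" "u' \<in> words" "v' \<in> words"
    and uv: "same_syllable u v" and uv': "same_syllable u' v'"
    and eq: "word_class u' = word_class v'"
  shows "same_syllable (u @ u') (v @ v')"
proof (cases "rest u")
  case None
  then have "rest v = None" "lead u = lead v"
    using uv by (auto simp: same_syllable_def split: option.splits)
  then show ?thesis
    using None uv' W
    by (auto simp: same_syllable_def lead_append rest_append inv_mult_left_multiple
        split: option.splits)
next
  case (Some iw)
  obtain i w where u: "rest u = Some (i, w)" using Some by (cases iw) auto
  then obtain z where v: "rest v = Some (i, z)"
    and k: "inv (lead v) \<otimes> lead u \<in> H i"
    and z: "base (\<rho> i (inv (lead v) \<otimes> lead u)) \<cdot> word_class w = word_class z"
    using uv by (auto simp: same_syllable_def split: option.splits)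
  have i: "i \<in> I" "w \<in> words" "z \<in> words"
    using rest_words[OF W(1) u] rest_words[OF W(2) v] by auto
  let ?k = "inv (lead v) \<otimes> lead u"
  have "base (\<rho> i ?k) \<cdot> word_class (w @ u') = word_class (z @ v')"
    using W i k \<rho>_closed[OF i(1)] z by (simp add: word_class_append eq flip: HNN.m_assoc)
  then show ?thesis
    using u v k W by (simp add: same_syllable_def lead_append rest_append)
qed

text \<open>A multiplication relation involves no stable letter. In the relation \<open>h t\<^sub>i = t\<^sub>i \<rho>\<^sub>i(h)\<close> the leading
  base elements are \<open>h\<close> and \<open>\<one>\<close>, and the quotient \<open>h \<in> H\<^sub>i\<close> is what the remainders \<open>[]\<close> and
  \<open>\<rho>\<^sub>i(h)\<close> have to make up for.\<close>

lemma same_syllable_relation: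
  assumes "(u, v) \<in> hnn_relations S I H \<rho>"
  shows "same_syllable u v"
proof -
  consider (mult) a b where "u = [Inl a, Inl b]" "v = hnn_word S (a \<otimes> b)"
      "a \<in> carrier S" "b \<in> carrier S"
    | (stable) h i where "u = hnn_word S h @ [Inr i]" "v = [Inr i] @ hnn_word S (\<rho> i h)"
      "i \<in> I" "h \<in> H i"
    using assms unfolding hnn_relations_def by blast
  then show ?thesis
  proof cases
    case mult
    then show ?thesis by (simp add: same_syllable_def)
  next
    case stable
    have h: "h \<in> carrier S" using stable H_carrier by blast
    have "lead u = h" "rest u = Some (i, [])"
      using stable h by (simp_all add: lead_append rest_append)
    moreover have "lead v = \<one>" "rest v = Some (i, hnn_word S (\<rho> i h))"
      using stable by simp_all
    ultimately show ?thesis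
      using stable h \<rho>_closed[of i h]
      by (simp add: same_syllable_def word_class_Nil flip: base_def)
  qed
qed

text \<open>Induction over the rules that generate the congruence. For concatenation the relation between
  the second parts is not enough: their classes must agree too, and they do because the rule
  has their congruence as a premise.\<close>

lemma same_syllable_presentation_cong:
  assumes "(u, v) \<in> presentation_cong (hnn_generators S I) (hnn_relations S I H \<rho>)"
  shows "same_syllable u v"
  using assms
proof induction
  case (rel u v)
  then show ?case by (simp add: same_syllable_relation)
next
  case (refl u)
  show ?case
  proof (cases "rest u")
    case None
    then show ?thesis by (simp add: same_syllable_def)
  next
    case (Some iw)
    then obtain i w where u: "rest u = Some (i, w)" by (cases iw) auto
    then show ?thesis
      using refl rest_words[OF refl u] by (simp add: same_syllable_def H_one \<rho>_one)
  qed
next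
  case (sym u v)
  show ?case using same_syllable_sym presentation_cong_in_lists[OF sym(1)] sym(2) by simp
next
  case (trans u v w)
  show ?case
    using same_syllable_trans[of u v w] presentation_cong_in_lists[OF trans(1)]
      presentation_cong_in_lists[OF trans(2)] trans(3,4) by simp
next
  case (append u v u' v')
  note W = presentation_cong_in_lists[OF append(1)] presentation_cong_in_lists[OF append(2)]
  have "word_class u' = word_class v'"
    using word_class_eq_iff append(2) W by simp
  then show ?case
    using same_syllable_append[of u v u' v'] W append(3,4) by simp
qed

lemma word_class_syllable:
  assumes g: "g \<in> carrier S" and i: "i \<in> I" and w: "w \<in> words"
  shows "base g \<cdot> stable_letter i \<cdot> word_class w = word_class (hnn_word S g @ [Inr i] @ w)"
proof -
  have "word_class (hnn_word S g @ [Inr i] @ w) = base g \<cdot> word_class ([Inr i] @ w)"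
    unfolding base_def by (rule word_class_append) (use g i w in simp_all)
  also have "word_class ([Inr i] @ w) = stable_letter i \<cdot> word_class w"
    unfolding stable_letter_def by (rule word_class_append) (use i w in simp_all)
  finally show ?thesis using g i w by (simp add: HNN.m_assoc)
qed

text \<open>The defining relations allow nothing more than moving elements of \<open>H\<^sub>i\<close> across \<open>t\<^sub>i\<close>.\<close>

lemma syllable_eqD:
  assumes g: "g \<in> carrier S" and h: "h \<in> carrier S" and i: "i \<in> I" and j: "j \<in> I"
    and m: "m \<in> carrier HNN" and n: "n \<in> carrier HNN"
    and eq: "base g \<cdot> stable_letter i \<cdot> m = base h \<cdot> stable_letter j \<cdot> n"
  shows "i = j" "inv h \<otimes> g \<in> H i" "base (\<rho> i (inv h \<otimes> g)) \<cdot> m = n"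
proof -
  obtain w where w: "w \<in> words" "m = word_class w" using HNN_elem_word[OF m] .
  obtain z where z: "z \<in> words" "n = word_class z" using HNN_elem_word[OF n] .
  let ?u = "hnn_word S g @ [Inr i] @ w" and ?v = "hnn_word S h @ [Inr j] @ z"
  have W: "?u \<in> words" "?v \<in> words" using g h i j w z by auto
  have "word_class ?u = word_class ?v"
    using eq word_class_syllable[OF g i w(1)] word_class_syllable[OF h j z(1)] w(2) z(2)
    by simp
  then have same: "same_syllable ?u ?v"
    using word_class_eq_iff[OF W] same_syllable_presentation_cong by simp
  have lr: "lead ?u = g" "rest ?u = Some (i, w)" "lead ?v = h" "rest ?v = Some (j, z)"
    using g h i j w(1) z(1) by (simp_all add: lead_append rest_append)
  note D = same[unfolded same_syllable_def lr prod.case option.case]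
  show "i = j" "inv h \<otimes> g \<in> H i" "base (\<rho> i (inv h \<otimes> g)) \<cdot> m = n"
    unfolding w(2) z(2)
    by (rule D[THEN conjunct1], rule D[THEN conjunct2, THEN conjunct1],
        rule D[THEN conjunct2, THEN conjunct2])
qed

lemma base_neq_syllable:
  assumes g: "g \<in> carrier S" and h: "h \<in> carrier S" and i: "i \<in> I" and m: "m \<in> carrier HNN"
  shows "base g \<noteq> base h \<cdot> stable_letter i \<cdot> m"
proof
  assume eq: "base g = base h \<cdot> stable_letter i \<cdot> m"
  obtain w where w: "w \<in> words" "m = word_class w" using HNN_elem_word[OF m] .
  let ?v = "hnn_word S h @ [Inr i] @ w"
  have W: "hnn_word S g \<in> words" "?v \<in> words" using g h i w by auto
  have "word_class (hnn_word S g) = word_class ?v"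
    using eq word_class_syllable[OF h i w(1)] w(2) by (simp add: base_def)
  then have "same_syllable (hnn_word S g) ?v"
    using word_class_eq_iff[OF W] same_syllable_presentation_cong by simp
  moreover have "rest ?v = Some (i, w)" by (simp add: rest_append g h)
  ultimately show False unfolding same_syllable_def lead_rest_hnn_word(2) by simp
qed

section \<open>HNN-extensions of groups are left Rees monoids\<close>

text \<open>Cancelling one syllable at a time: comparing a syllable with itself moves \<open>\<one> \<in> H\<^sub>i\<close> across the
  stable letter, so the remainders are equal.\<close>

lemma HNN_left_cancel:
  assumes "x \<in> carrier HNN" "m \<in> carrier HNN" "n \<in> carrier HNN" "x \<cdot> m = x \<cdot> n"
  shows "m = n"
  using assms(1,4)
proof (induction rule: HNN_induct)
  case (base g)
  then show ?case using base_Units assms(2,3) by simp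
next
  case (syllable g i x)
  have "base g \<cdot> stable_letter i \<cdot> (x \<cdot> m) = base g \<cdot> stable_letter i \<cdot> (x \<cdot> n)"
    using syllable assms(2,3) by (simp add: HNN.m_assoc)
  from syllable_eqD(3)[OF _ _ _ _ _ _ this]
  have "x \<cdot> m = x \<cdot> n" using syllable assms(2,3) by (simp add: \<rho>_one)
  then show ?case by (rule syllable.IH)
qed

lemma syllable_change_coset:
  assumes g: "g \<in> carrier S" and h: "h \<in> carrier S" and i: "i \<in> I" and m: "m \<in> carrier HNN"
    and k: "inv h \<otimes> g \<in> H i"
  shows "base g \<cdot> stable_letter i \<cdot> m =
    base h \<cdot> stable_letter i \<cdot> (base (\<rho> i (inv h \<otimes> g)) \<cdot> m)"
proof -
  have "g = h \<otimes> (inv h \<otimes> g)" using g h by (simp add: inv_mult_cancel)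
  then have "base g \<cdot> stable_letter i = base h \<cdot> (base (inv h \<otimes> g) \<cdot> stable_letter i)"
    using g h i base_mult[of h "inv h \<otimes> g"] by (simp add: HNN.m_assoc)
  then show ?thesis
    using g h i m k \<rho>_closed[OF i k] by (simp add: base_stable_letter HNN.m_assoc)
qed

lemma base_divides: "g \<in> carrier S \<Longrightarrow> x \<in> carrier HNN \<Longrightarrow> base g divides\<^bsub>HNN\<^esub> x"
  by (rule HNN.unit_divides[OF base_Units])

text \<open>The correcting element \<open>\<rho>\<^sub>i(g\<inverse>h)\<close> can be absorbed into \<open>y\<close>. So any left factor of
  \<open>g \<cdot> t\<^sub>i \<cdot> x\<close> that is not a base element can be rewritten to start with that same syllable, and the induction proofs can strip it.\<close>

lemma syllable_factorization:
  assumes g: "g \<in> carrier S" and h: "h \<in> carrier S" and i: "i \<in> I" and j: "j \<in> I"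
    and x: "x \<in> carrier HNN" and y: "y \<in> carrier HNN" and q: "q \<in> carrier HNN"
    and eq: "base g \<cdot> stable_letter i \<cdot> x = base h \<cdot> stable_letter j \<cdot> y \<cdot> q"
  obtains y' where "y' \<in> carrier HNN" "x = y' \<cdot> q"
    and "base h \<cdot> stable_letter j \<cdot> y = base g \<cdot> stable_letter i \<cdot> y'"
proof -
  have "base h \<cdot> stable_letter j \<cdot> (y \<cdot> q) = base g \<cdot> stable_letter i \<cdot> x"
    using assms by (simp add: HNN.m_assoc)
  note D = syllable_eqD[OF h g j i _ x this]
  have k: "j = i" "inv g \<otimes> h \<in> H i" "base (\<rho> i (inv g \<otimes> h)) \<cdot> (y \<cdot> q) = x"
    using D y q by simp_all
  show thesis
  proof
    show "base (\<rho> i (inv g \<otimes> h)) \<cdot> y \<in> carrier HNN" using \<rho>_closed[OF i k(2)] y by simp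
    show "x = base (\<rho> i (inv g \<otimes> h)) \<cdot> y \<cdot> q"
      using k \<rho>_closed[OF i k(2)] y q by (simp add: HNN.m_assoc)
    show "base h \<cdot> stable_letter j \<cdot> y =
        base g \<cdot> stable_letter i \<cdot> (base (\<rho> i (inv g \<otimes> h)) \<cdot> y)"
      using syllable_change_coset[OF h g i y k(2)] k(1) by simp
  qed
qed

text \<open>If neither factor is a unit, they share a first syllable; removing it reduces the claim to the
  remainders.\<close>

lemma HNN_rigid:
  assumes "x \<in> carrier HNN" "y \<in> carrier HNN" "p \<in> carrier HNN" "q \<in> carrier HNN"
    and "x \<cdot> p = y \<cdot> q"
  shows "x divides\<^bsub>HNN\<^esub> y \<or> y divides\<^bsub>HNN\<^esub> x"
  using assms(1,2,5)
proof (induction arbitrary: y rule: HNN_induct)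
  case (base g)
  then show ?case using base_divides by blast
next
  case (syllable g i x)
  note s_hyps = syllable.hyps
  let ?s = "base g \<cdot> stable_letter i"
  have s: "?s \<in> carrier HNN" using syllable.hyps by simp
  from syllable.prems(1) show ?case
  proof (cases rule: HNN_cases)
    case (base h)
    then show ?thesis using base_divides s syllable.hyps by simp
  next
    case (syllable h j y')
    note y = syllable
    have "?s \<cdot> (x \<cdot> p) = base h \<cdot> stable_letter j \<cdot> y' \<cdot> q"
      using syllable.prems(2) y s s_hyps(3) assms(3) by (simp add: HNN.m_assoc)
    then obtain y'' where "y'' \<in> carrier HNN" "x \<cdot> p = y'' \<cdot> q" "y = ?s \<cdot> y''"
      unfolding y(4)
      by (rule syllable_factorization[OF s_hyps(1) y(1) s_hyps(2) y(2)
            HNN.m_closed[OF s_hyps(3) assms(3)] y(3) assms(4)])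
    then show ?thesis
      using syllable.IH[of y''] HNN.divides_mult_lI[OF _ _ s] s_hyps(3) by blast
  qed
qed

text \<open>A left factor of \<open>s \<cdot> x\<close>, where \<open>s\<close> is a syllable, is either a base element, which generates the
  whole monoid, or \<open>s\<close> times a left factor of \<open>x\<close>. Hence each syllable adds at most one ideal.\<close>

lemma finite_HNN_right_ideals_above:
  assumes "x \<in> carrier HNN"
  shows "finite (right_ideals_above HNN x)"
  using assms
proof (induction rule: HNN_induct)
  case (base g)
  have "right_ideal HNN y = carrier HNN"
    if y: "y \<in> carrier HNN" "y divides\<^bsub>HNN\<^esub> base g" for y
  proof -
    have "y divides\<^bsub>HNN\<^esub> z" if "z \<in> carrier HNN" for z
      using y base base_divides[of g z] that HNN.divides_trans by blast
    then show ?thesis using y HNN.right_ideal_eq_carrier by blast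
  qed
  then have "right_ideals_above HNN (base g) \<subseteq> {carrier HNN}"
    by (auto simp: right_ideals_above_def)
  then show ?case using finite_subset by blast
next
  case (syllable g i x)
  note s_hyps = syllable.hyps
  let ?s = "base g \<cdot> stable_letter i"
  have s: "?s \<in> carrier HNN" using syllable.hyps by simp
  have "right_ideal HNN y \<in>
      insert (carrier HNN) (l_coset HNN ?s ` right_ideals_above HNN x)"
    if yc: "y \<in> carrier HNN" and dvd: "y divides\<^bsub>HNN\<^esub> ?s \<cdot> x" for y
    using yc
  proof (cases rule: HNN_cases)
    case (base h)
    then have "right_ideal HNN y = carrier HNN"
      using base_divides yc HNN.right_ideal_eq_carrier by blast
    then show ?thesis by simp
  next
    case (syllable h j y')
    note y = syllable
    obtain q where q: "q \<in> carrier HNN" "?s \<cdot> x = y \<cdot> q" using dvd by auto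
    obtain y'' where y'': "y'' \<in> carrier HNN" "x = y'' \<cdot> q" "y = ?s \<cdot> y''"
      unfolding y(4)
      by (rule syllable_factorization[OF s_hyps(1) y(1) s_hyps(2) y(2) s_hyps(3) y(3) q(1)
            q(2)[unfolded y(4)]])
    then have "right_ideal HNN y = l_coset HNN ?s (right_ideal HNN y'')"
      using HNN.right_ideal_mult[OF s] by simp
    then show ?thesis using y'' q(1) by (auto simp: right_ideals_above_def)
  qed
  then have "right_ideals_above HNN (?s \<cdot> x) \<subseteq>
      insert (carrier HNN) (l_coset HNN ?s ` right_ideals_above HNN x)"
    unfolding right_ideals_above_def by blast
  then show ?case using syllable.IH finite_subset by blast
qed

text \<open>An inverse of a stable letter would turn a product that starts with a syllable into \<open>\<one>\<close>. At
  least one stable letter exists because the index set is non-empty.\<close>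

lemma HNN_not_group: "\<not> group HNN"
proof
  assume "group HNN"
  then interpret P: group HNN .
  obtain i where i: "i \<in> I" using I_nonempty by blast
  have "stable_letter i \<cdot> inv\<^bsub>HNN\<^esub> (stable_letter i) = \<one>\<^bsub>HNN\<^esub>" using i by simp
  then have "base \<one> = base \<one> \<cdot> stable_letter i \<cdot> inv\<^bsub>HNN\<^esub> (stable_letter i)" using i by simp
  moreover have "inv\<^bsub>HNN\<^esub> (stable_letter i) \<in> carrier HNN" using i by simp
  ultimately show False using base_neq_syllable[OF one_closed one_closed i] by blast
qed

theorem left_rees_HNN: "left_rees_monoid HNN"
  unfolding HNN.left_rees_monoid_iff
proof (intro conjI ballI impI)
qed (fact HNN_left_cancel HNN_rigid finite_HNN_right_ideals_above HNN_not_group)+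

end


section \<open>Units and irreducible elements of a left Rees monoid\<close>

locale left_rees = monoid M for M :: "('a, 'n) monoid_scheme" (structure) +
  assumes l_cancel: "\<lbrakk>a \<otimes> b = a \<otimes> c; a \<in> carrier M; b \<in> carrier M; c \<in> carrier M\<rbrakk> \<Longrightarrow> b = c"
    and rigid: "\<lbrakk>a \<otimes> p = b \<otimes> q; a \<in> carrier M; b \<in> carrier M; p \<in> carrier M; q \<in> carrier M\<rbrakk> \<Longrightarrow>
      a divides b \<or> b divides a"
    and finite_above: "a \<in> carrier M \<Longrightarrow> finite (right_ideals_above M a)"
    and not_group: "\<not> group M"
begin

lemma right_invertible_Units:
  assumes "a \<in> carrier M" "b \<in> carrier M" "a \<otimes> b = \<one>"
  shows "a \<in> Units M"
proof -
  have "a \<otimes> (b \<otimes> a) = a \<otimes> \<one>" using assms by (simp flip: m_assoc)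
  then have "b \<otimes> a = \<one>" by (rule l_cancel) (use assms in simp_all)
  then show ?thesis using assms by (auto simp: Units_def)
qed

lemma divides_one_Units: "a \<in> carrier M \<Longrightarrow> a divides \<one> \<Longrightarrow> a \<in> Units M"
  using right_invertible_Units by (metis dividesE)

lemma divides_unit_Units:
  assumes "a \<in> carrier M" "u \<in> Units M" "a divides u"
  shows "a \<in> Units M"
  using assms divides_one_Units divides_trans unit_divides one_closed by metis

lemma unit_cancel:
  assumes u: "u \<in> Units M" and x: "x \<in> carrier M"
  shows "inv u \<otimes> (u \<otimes> x) = x" "u \<otimes> (inv u \<otimes> x) = x"
proof -
  have "u \<in> carrier M" using u by auto
  then show "inv u \<otimes> (u \<otimes> x) = x" "u \<otimes> (inv u \<otimes> x) = x"
    using u x by (simp_all flip: m_assoc)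
qed

lemma mutual_divides_unit:
  assumes a: "a \<in> carrier M" and b: "b \<in> carrier M"
    and ab: "a divides b" and ba: "b divides a"
  obtains u where "u \<in> Units M" "a = b \<otimes> u"
proof -
  obtain c where c: "b = a \<otimes> c" "c \<in> carrier M" using ab by (rule dividesE)
  obtain d where d: "a = b \<otimes> d" "d \<in> carrier M" using ba by (rule dividesE)
  have "b \<otimes> (d \<otimes> c) = b \<otimes> \<one>" using b c d by (metis m_assoc r_one)
  then have "d \<otimes> c = \<one>" by (rule l_cancel) (use b c(2) d(2) in simp_all)
  then show thesis using that right_invertible_Units c(2) d by blast
qed

text \<open>An irreducible element generates a maximal proper principal right ideal. Two of these that meet
  are comparable by rigidity, hence equal.\<close>

lemma irreducibles_meet:
  assumes a: "a \<in> carrier M" "irreducible M a" and b: "b \<in> carrier M" "irreducible M b"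
    and p: "p \<in> carrier M" and q: "q \<in> carrier M" and eq: "a \<otimes> p = b \<otimes> q"
  obtains u where "u \<in> Units M" "a = b \<otimes> u"
proof -
  have "a divides b \<Longrightarrow> b divides a" "b divides a \<Longrightarrow> a divides b"
    using a b unfolding irreducible_def properfactor_def by blast+
  then have "a divides b" "b divides a" using rigid[OF eq] a b p q by blast+
  then show thesis using mutual_divides_unit[OF a(1) b(1)] that by blast
qed

definition height :: "'a \<Rightarrow> nat" where
  "height a = card (right_ideals_above M a)"

lemma height_properfactor:
  assumes a: "a \<in> carrier M" and b: "b \<in> carrier M" and ba: "properfactor M b a"
  shows "height b < height a"
  unfolding height_def
proof (rule psubset_card_mono[OF finite_above[OF a]])
  have ba': "b divides a" "\<not> a divides b" using ba by (auto simp: properfactor_def)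
  have "right_ideals_above M b \<subseteq> right_ideals_above M a"
    unfolding right_ideals_above_def using divides_trans[OF _ ba'(1)] by blast
  moreover have "right_ideal M a \<in> right_ideals_above M a"
    using a by (auto simp: right_ideals_above_def)
  moreover have "right_ideal M a \<notin> right_ideals_above M b"
  proof
    assume "right_ideal M a \<in> right_ideals_above M b"
    then obtain c where c: "right_ideal M a = right_ideal M c" "c \<in> carrier M" "c divides b"
      by (auto simp: right_ideals_above_def)
    have "b \<in> right_ideal M c" using c(3) by (simp add: mem_right_ideal_iff)
    then have "a divides b" using c(1) mem_right_ideal_iff by blast
    then show False using ba'(2) by contradiction
  qed
  ultimately show "right_ideals_above M b \<subset> right_ideals_above M a" by blast
qed

text \<open>Left multiplication by \<open>b\<close> embeds the ideals above \<open>c\<close> into those above \<open>b \<otimes> c\<close>. It misses the whole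
  monoid, which is an ideal above \<open>b \<otimes> c\<close>, because \<open>b\<close> is not a unit. A right factor is not
  a factor in the sense of \<open>divides\<close>, so this is not covered by \<open>height_properfactor\<close>.\<close>

lemma height_right_factor:
  assumes b: "b \<in> carrier M" "b \<notin> Units M" and c: "c \<in> carrier M"
  shows "height c < height (b \<otimes> c)"
proof -
  have sub: "J \<subseteq> carrier M" if "J \<in> right_ideals_above M c" for J
    using that by (auto simp: right_ideals_above_def l_coset_def)
  have "inj_on (l_coset M b) (Pow (carrier M))"
  proof (rule inj_onI)
    fix J K assume J: "J \<in> Pow (carrier M)" and K: "K \<in> Pow (carrier M)"
      and eq: "l_coset M b J = l_coset M b K"
    have *: "A \<subseteq> B" if "A \<subseteq> carrier M" "B \<subseteq> carrier M" "l_coset M b A \<subseteq> l_coset M b B" for A B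
    proof
      fix x assume x: "x \<in> A"
      then have "b \<otimes> x \<in> l_coset M b B" using that(3) by (auto simp: l_coset_def)
      then obtain y where "y \<in> B" "b \<otimes> x = b \<otimes> y" by (auto simp: l_coset_def)
      then show "x \<in> B" using l_cancel[of b x y] b(1) x that(1,2) by blast
    qed
    show "J = K" using *[of J K] *[of K J] J K eq by auto
  qed
  then have inj: "inj_on (l_coset M b) (right_ideals_above M c)"
    by (rule inj_on_subset) (use sub in blast)
  have "l_coset M b ` right_ideals_above M c \<subseteq> right_ideals_above M (b \<otimes> c)"
  proof
    fix K assume "K \<in> l_coset M b ` right_ideals_above M c"
    then obtain d where d: "d \<in> carrier M" "d divides c" "K = right_ideal M (b \<otimes> d)"
      using right_ideal_mult[OF b(1)] by (auto simp: right_ideals_above_def)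
    then show "K \<in> right_ideals_above M (b \<otimes> c)"
      using b(1) divides_mult_lI[OF d(2,1) b(1)] by (auto simp: right_ideals_above_def)
  qed
  moreover have "right_ideal M \<one> \<in> right_ideals_above M (b \<otimes> c)"
    using b(1) c by (auto simp: right_ideals_above_def intro!: unit_divides)
  moreover have "right_ideal M \<one> \<notin> l_coset M b ` right_ideals_above M c"
  proof
    assume "right_ideal M \<one> \<in> l_coset M b ` right_ideals_above M c"
    then obtain J where J: "J \<in> right_ideals_above M c" "right_ideal M \<one> = l_coset M b J" by blast
    have "\<one> \<in> right_ideal M \<one>" by (simp add: mem_right_ideal_iff)
    then obtain x where "x \<in> J" "\<one> = b \<otimes> x" using J(2) by (auto simp: l_coset_def)
    then show False using right_invertible_Units[OF b(1)] b(2) sub[OF J(1)] by auto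
  qed
  ultimately have "l_coset M b ` right_ideals_above M c \<subset> right_ideals_above M (b \<otimes> c)" by blast
  then have "card (l_coset M b ` right_ideals_above M c) < card (right_ideals_above M (b \<otimes> c))"
    by (rule psubset_card_mono[rotated]) (use finite_above b(1) c in simp)
  then show ?thesis by (simp add: height_def card_image[OF inj])
qed

text \<open>An element that is neither a unit nor irreducible has a proper left factor \<open>b\<close> that is not a unit,
  and both \<open>b\<close> and its cofactor have smaller height.\<close>

lemma factorization_induct [consumes 1, case_names unit irreducible mult]:
  assumes a: "a \<in> carrier M"
    and unit: "\<And>u. u \<in> Units M \<Longrightarrow> Q u"
    and irr: "\<And>a. a \<in> carrier M \<Longrightarrow> irreducible M a \<Longrightarrow> Q a"
    and mult: "\<And>a b. a \<in> carrier M \<Longrightarrow> b \<in> carrier M \<Longrightarrow> Q a \<Longrightarrow> Q b \<Longrightarrow> Q (a \<otimes> b)"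
  shows "Q a"
  using a
proof (induction "height a" arbitrary: a rule: less_induct)
  case less
  show ?case
  proof (cases "a \<in> Units M \<or> irreducible M a")
    case True
    then show ?thesis using unit irr less.prems by blast
  next
    case False
    then obtain b where b: "b \<in> carrier M" "properfactor M b a" "b \<notin> Units M"
      unfolding irreducible_def by blast
    then obtain c where c: "a = b \<otimes> c" "c \<in> carrier M"
      unfolding properfactor_def by auto
    have "Q b" using less.hyps[OF height_properfactor[OF less.prems b(1,2)] b(1)] .
    moreover have "Q c"
      using less.hyps[OF _ c(2)] height_right_factor[OF b(1,3) c(2)] c(1) by simp
    ultimately show ?thesis using mult b(1) c by simp
  qed
qed

section \<open>Double cosets of irreducibles as stable letters\<close>

definition double_coset :: "'a \<Rightarrow> 'a set" where
  "double_coset a = {g \<otimes> a \<otimes> h | g h. g \<in> Units M \<and> h \<in> Units M}"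

text \<open>The choice depends only on the double coset and not on \<open>a\<close>, so \<open>rep\<close> is constant on double
  cosets.\<close>

definition rep :: "'a \<Rightarrow> 'a" where
  "rep a = (SOME t. t \<in> double_coset a)"

definition transversal :: "'a set" where
  "transversal = rep ` {a \<in> carrier M. irreducible M a}"

text \<open>The stabilizer of the right ideal of \<open>t\<close> under left multiplication by units.\<close>

definition stab :: "'a \<Rightarrow> 'a set" where
  "stab t = {g \<in> Units M. \<exists>k \<in> Units M. g \<otimes> t = t \<otimes> k}"

text \<open>The effect of moving a unit from the left to the right of \<open>t\<close>; the value is unique by left
  cancellation and meaningful on \<open>stab t\<close>.\<close>

definition twist :: "'a \<Rightarrow> 'a \<Rightarrow> 'a" where
  "twist t g = (THE k. k \<in> Units M \<and> g \<otimes> t = t \<otimes> k)"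

lemma double_coset_refl: "a \<in> carrier M \<Longrightarrow> a \<in> double_coset a"
  unfolding double_coset_def by (auto intro!: exI[of _ \<one>])

lemma double_coset_subset:
  assumes a: "a \<in> carrier M" and b: "b \<in> double_coset a"
  shows "double_coset b \<subseteq> double_coset a"
proof
  fix x assume "x \<in> double_coset b"
  then obtain g h where x: "x = g \<otimes> b \<otimes> h" "g \<in> Units M" "h \<in> Units M"
    by (auto simp: double_coset_def)
  obtain g' h' where b': "b = g' \<otimes> a \<otimes> h'" "g' \<in> Units M" "h' \<in> Units M"
    using b by (auto simp: double_coset_def)
  have "x = (g \<otimes> g') \<otimes> a \<otimes> (h' \<otimes> h)" using x b' a by (simp add: m_assoc Units_closed)
  then show "x \<in> double_coset a" unfolding double_coset_def using x b' Units_m_closed by blast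
qed

lemma double_coset_sym:
  assumes a: "a \<in> carrier M" and b: "b \<in> double_coset a"
  shows "a \<in> double_coset b"
proof -
  obtain g h where b': "b = g \<otimes> a \<otimes> h" "g \<in> Units M" "h \<in> Units M"
    using b by (auto simp: double_coset_def)
  have "a = inv g \<otimes> b \<otimes> inv h"
    unfolding b'(1) using b' a by (simp add: m_assoc Units_closed unit_cancel)
  then show ?thesis unfolding double_coset_def using b' Units_inv_Units by blast
qed

lemma double_coset_carrier: "a \<in> carrier M \<Longrightarrow> double_coset a \<subseteq> carrier M"
  by (auto simp: double_coset_def)

lemma double_coset_eq:
  assumes "a \<in> carrier M" "b \<in> double_coset a"
  shows "double_coset b = double_coset a"
proof
  show "double_coset b \<subseteq> double_coset a" using double_coset_subset[OF assms] .
  show "double_coset a \<subseteq> double_coset b"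
    using double_coset_subset[OF _ double_coset_sym[OF assms]] double_coset_carrier[OF assms(1)]
      assms(2) by blast
qed

lemma rep_double_coset: "a \<in> carrier M \<Longrightarrow> rep a \<in> double_coset a"
  unfolding rep_def using double_coset_refl by (rule someI)

lemma irreducible_double_coset:
  assumes a: "a \<in> carrier M" "irreducible M a" and b: "b \<in> double_coset a"
  shows "irreducible M b"
proof -
  obtain g h where b': "b = g \<otimes> a \<otimes> h" "g \<in> Units M" "h \<in> Units M"
    using b by (auto simp: double_coset_def)
  have gc: "g \<in> carrier M" "h \<in> carrier M" using b' by auto
  have aU: "a \<notin> Units M" using a(2) by (simp add: irreducible_def)
  show ?thesis unfolding irreducible_def
  proof (intro conjI ballI impI)
    show "b \<notin> Units M"
    proof
      assume "b \<in> Units M"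
      then have "g \<otimes> a \<in> Units M" using prod_unit_r[of "g \<otimes> a" h] b' a gc by simp
      then show False using prod_unit_l[of g a] b'(2) a gc aU by simp
    qed
    fix c assume c: "c \<in> carrier M" and cb: "properfactor M c b"
    have "properfactor M (inv g \<otimes> c) a"
    proof (rule properfactorI)
      obtain d where d: "b = c \<otimes> d" "d \<in> carrier M" using cb by (auto simp: properfactor_def)
      have "g \<otimes> a = b \<otimes> inv h" using b' a gc by (simp add: m_assoc)
      then have "a = inv g \<otimes> (c \<otimes> d \<otimes> inv h)"
        using unit_cancel(1)[OF b'(2) a(1)] d(1) by simp
      then have "a = inv g \<otimes> c \<otimes> (d \<otimes> inv h)" using c d(2) b' by (simp add: m_assoc)
      then show "(inv g \<otimes> c) divides a" using d(2) b' by (intro dividesI) auto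
      show "\<not> a divides (inv g \<otimes> c)"
      proof
        assume "a divides (inv g \<otimes> c)"
        then obtain e where e: "inv g \<otimes> c = a \<otimes> e" "e \<in> carrier M" by (rule dividesE)
        have "c = g \<otimes> (inv g \<otimes> c)" using unit_cancel(2)[OF b'(2) c] by simp
        also have "\<dots> = b \<otimes> (inv h \<otimes> e)"
          unfolding e(1) b'(1) using a gc b' e(2) by (simp add: m_assoc unit_cancel)
        finally have "b divides c" using e(2) b' by (intro dividesI) auto
        then show False using cb by (simp add: properfactor_def)
      qed
    qed
    then have "inv g \<otimes> c \<in> Units M" using a(2) c b'(2) by (simp add: irreducible_def)
    then show "c \<in> Units M" using prod_unit_l[of "inv g" c] c b'(2) by simp
  qed
qed

lemma transversal_irreducible:
  assumes "t \<in> transversal"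
  shows "t \<in> carrier M" "irreducible M t"
  using assms rep_double_coset double_coset_carrier irreducible_double_coset
  unfolding transversal_def by blast+

lemma transversal_unique:
  assumes t: "t \<in> transversal" and s: "s \<in> transversal" and ts: "t \<in> double_coset s"
  shows "t = s"
proof -
  have rep: "rep x = x" if x: "x \<in> transversal" for x
  proof -
    obtain a where a: "a \<in> carrier M" "x = rep a" using x by (auto simp: transversal_def)
    then have "double_coset x = double_coset a" using double_coset_eq rep_double_coset by blast
    then show ?thesis using a(2) by (simp add: rep_def)
  qed
  have "double_coset t = double_coset s"
    using double_coset_eq[OF transversal_irreducible(1)[OF s] ts] .
  then have "rep t = rep s" by (simp add: rep_def)
  then show ?thesis using rep t s by simp
qed

lemma irreducible_transversal:
  assumes "a \<in> carrier M" "irreducible M a"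
  obtains g t h where "g \<in> Units M" "t \<in> transversal" "h \<in> Units M" "a = g \<otimes> t \<otimes> h"
proof -
  have "a \<in> double_coset (rep a)"
    using double_coset_sym[OF assms(1) rep_double_coset[OF assms(1)]] .
  then show thesis using that assms by (auto simp: double_coset_def transversal_def)
qed

text \<open>Without irreducible elements every element would be a product of units, and the monoid would be
  a group.\<close>

lemma transversal_nonempty: "transversal \<noteq> {}"
proof
  assume empty: "transversal = {}"
  have "a \<in> Units M" if "a \<in> carrier M" for a
    using that
  proof (induction rule: factorization_induct)
    case (irreducible a)
    then show ?case using empty by (auto simp: transversal_def)
  qed auto
  then have "group M" by unfold_locales auto
  then show False using not_group by contradiction
qed

lemma twist_eq:
  assumes "t \<in> carrier M" "g \<in> Units M" "k \<in> Units M" "g \<otimes> t = t \<otimes> k"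
  shows "twist t g = k"
  unfolding twist_def
proof (rule the_equality)
  fix k' assume "k' \<in> Units M \<and> g \<otimes> t = t \<otimes> k'"
  then show "k' = k" using l_cancel[of t k' k] assms by auto
qed (use assms in simp)

lemma stab_twist:
  assumes t: "t \<in> carrier M" and g: "g \<in> stab t"
  shows "g \<in> Units M" "twist t g \<in> Units M" "g \<otimes> t = t \<otimes> twist t g"
proof -
  obtain k where "g \<in> Units M" "k \<in> Units M" "g \<otimes> t = t \<otimes> k" using g by (auto simp: stab_def)
  then show "g \<in> Units M" "twist t g \<in> Units M" "g \<otimes> t = t \<otimes> twist t g"
    using twist_eq[OF t] by auto
qed

lemma stab_mult:
  assumes t: "t \<in> carrier M" and g: "g \<in> stab t" and h: "h \<in> stab t"
  shows "g \<otimes> h \<in> stab t" "twist t (g \<otimes> h) = twist t g \<otimes> twist t h"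
proof -
  note g' = stab_twist[OF t g] and h' = stab_twist[OF t h]
  have "g \<otimes> h \<otimes> t = g \<otimes> t \<otimes> twist t h"
    using g'(1) h' t by (simp add: m_assoc Units_closed)
  also have "\<dots> = t \<otimes> (twist t g \<otimes> twist t h)"
    unfolding g'(3) using g' h' t by (simp add: m_assoc Units_closed)
  finally have eq: "g \<otimes> h \<otimes> t = t \<otimes> (twist t g \<otimes> twist t h)" .
  show "g \<otimes> h \<in> stab t" unfolding stab_def using eq g' h' Units_m_closed by blast
  show "twist t (g \<otimes> h) = twist t g \<otimes> twist t h"
    using twist_eq[OF t _ _ eq] g' h' by simp
qed

lemma stab_one:
  assumes "t \<in> carrier M"
  shows "\<one> \<in> stab t" "twist t \<one> = \<one>"
  using assms twist_eq[OF assms, of \<one> \<one>] by (auto simp: stab_def intro!: bexI[of _ \<one>])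

lemma stab_inv:
  assumes t: "t \<in> carrier M" and g: "g \<in> stab t"
  shows "inv g \<in> stab t"
proof -
  note g' = stab_twist[OF t g]
  have "inv g \<otimes> t = inv g \<otimes> (t \<otimes> twist t g) \<otimes> inv (twist t g)"
    using g' t by (simp add: m_assoc Units_closed)
  also have "\<dots> = t \<otimes> inv (twist t g)"
    unfolding g'(3)[symmetric] using unit_cancel(1)[OF g'(1) t] by simp
  finally show ?thesis unfolding stab_def using g' Units_inv_Units by blast
qed

sublocale data: group_hnn_data "units_of M" transversal stab twist
proof (intro group_hnn_data.intro monoid_hnn_data.intro monoid_hnn_data_axioms.intro
    group_hnn_data_axioms.intro)
  show "group (units_of M)" by (rule units_group)
  then show "monoid (units_of M)" by (rule group.is_monoid)
  show "transversal \<noteq> {}" by (rule transversal_nonempty)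
  fix t assume "t \<in> transversal"
  then have t: "t \<in> carrier M" by (rule transversal_irreducible)
  show sub: "subgroup (stab t) (units_of M)"
  proof (rule group.subgroupI[OF units_group])
    show "stab t \<subseteq> carrier (units_of M)" using stab_twist(1)[OF t] by (auto simp: units_of_def)
    show "stab t \<noteq> {}" using stab_one(1)[OF t] by blast
  next
    fix g assume "g \<in> stab t"
    then show "inv\<^bsub>units_of M\<^esub> g \<in> stab t"
      using stab_inv[OF t] stab_twist(1)[OF t] by (simp add: units_of_inv)
  next
    fix g h assume "g \<in> stab t" "h \<in> stab t"
    then show "g \<otimes>\<^bsub>units_of M\<^esub> h \<in> stab t"
      using stab_mult(1)[OF t] by (simp add: units_of_mult)
  qed
  show "submonoid (stab t) (units_of M)"
    using stab_twist(1)[OF t] stab_mult(1)[OF t] stab_one(1)[OF t]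
    by (intro submonoid.intro) (auto simp: units_of_def)
  show "twist t \<in> hom (units_of M\<lparr>carrier := stab t\<rparr>) (units_of M)"
    using stab_twist(2)[OF t] stab_mult(2)[OF t] by (auto simp: units_of_def hom_def)
  show "twist t \<one>\<^bsub>units_of M\<^esub> = \<one>\<^bsub>units_of M\<^esub>"
    using stab_one(2)[OF t] by (simp add: units_of_one)
qed

section \<open>The isomorphism with the HNN-extension of the group of units\<close>

lemma word_value_hnn_word:
  "s \<in> carrier M \<Longrightarrow> word_value M (case_sum id f) (hnn_word (units_of M) s) = s"
  by (simp add: hnn_word_def units_of_one)

text \<open>The universal property applies because the equation that defines \<open>twist\<close> is the
  defining relation of the HNN-extension, read in \<open>M\<close>.\<close>

lemma hnn_hom:
  obtains \<phi> where "\<phi> \<in> hom data.HNN M"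
    and "\<And>g. g \<in> Units M \<Longrightarrow> \<phi> (data.base g) = g"
    and "\<And>t. t \<in> transversal \<Longrightarrow> \<phi> (data.stable_letter t) = t"
proof -
  let ?f = "case_sum id id :: 'a + 'a \<Rightarrow> 'a"
  let ?X = "hnn_generators (units_of M) transversal :: ('a + 'a) set"
  let ?R = "hnn_relations (units_of M) transversal stab twist"
  have f: "?f \<in> ?X \<rightarrow> carrier M"
    using transversal_irreducible(1) by (auto simp: hnn_generators_def units_of_carrier)
  have R: "word_value M ?f u = word_value M ?f v" if "(u, v) \<in> ?R" for u v
  proof -
    consider (mult) a b where "u = [Inl a, Inl b]" "v = hnn_word (units_of M) (a \<otimes> b)"
        "a \<in> Units M" "b \<in> Units M"
      | (stable) h t where "u = hnn_word (units_of M) h @ [Inr t]"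
        "v = [Inr t] @ hnn_word (units_of M) (twist t h)" "t \<in> transversal" "h \<in> stab t"
      using \<open>(u, v) \<in> ?R\<close> unfolding hnn_relations_def units_of_carrier units_of_mult by blast
    then show ?thesis
    proof cases
      case mult
      then show ?thesis by (simp add: word_value_hnn_word Units_closed)
    next
      case stable
      have t: "t \<in> carrier M" using stable transversal_irreducible by blast
      note h = stab_twist[OF t stable(4)]
      have "hnn_word (units_of M) h \<in> lists ?X" "[Inr t] \<in> lists ?X"
        using data.hnn_word_words[of h] data.Inr_words[of t] h(1) stable(3)
        by (simp_all add: units_of_carrier)
      from word_value_append[OF f this] show ?thesis
        using stable h t by (simp add: word_value_hnn_word Units_closed)
    qed
  qed
  obtain \<phi> where \<phi>: "\<phi> \<in> hom (presented_monoid ?X ?R) M"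
    "\<And>w. w \<in> lists ?X \<Longrightarrow> \<phi> (presentation_cong ?X ?R `` {w}) = word_value M ?f w"
    using presented_monoid_lift[OF f R] by blast
  show thesis
  proof
    show "\<phi> \<in> hom data.HNN M" using \<phi>(1) by (simp add: hnn_extension_def)
    show "\<phi> (data.base g) = g" if "g \<in> Units M" for g
      using \<phi>(2)[OF data.hnn_word_words[of g]] that
      by (simp add: data.base_def data.word_class_def units_of_carrier word_value_hnn_word
          Units_closed)
    show "\<phi> (data.stable_letter t) = t" if "t \<in> transversal" for t
    proof -
      have "[Inr t] \<in> lists ?X" using data.Inr_words[OF that] by simp
      then show ?thesis
        using \<phi>(2)[of "[Inr t]"] transversal_irreducible(1)[OF that]
        by (simp add: data.stable_letter_def data.word_class_def)
    qed
  qed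
qed

text \<open>The analogue of \<open>syllable_eqD\<close> inside \<open>M\<close>: the products \<open>g \<otimes> t\<close> and \<open>h \<otimes> s\<close> are irreducible
  and have a common right multiple, so they differ by a unit \<open>u\<close> on the right. Then \<open>t\<close> and \<open>s\<close>
  lie in one double coset, and \<open>u\<close> is the value of \<open>twist\<close> at \<open>h\<inverse>g\<close>.\<close>

lemma syllables_meet:
  assumes g: "g \<in> Units M" and h: "h \<in> Units M"
    and t: "t \<in> transversal" and s: "s \<in> transversal"
    and x: "x \<in> carrier M" and y: "y \<in> carrier M"
    and eq: "g \<otimes> t \<otimes> x = h \<otimes> s \<otimes> y"
  shows "t = s" "inv h \<otimes> g \<in> stab t" "twist t (inv h \<otimes> g) \<otimes> x = y"
proof -
  note tc = transversal_irreducible[OF t] and sc = transversal_irreducible[OF s]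
  have gh: "g \<in> carrier M" "h \<in> carrier M" using g h by auto
  have irr: "irreducible M (c \<otimes> r)" if "c \<in> Units M" "r \<in> transversal" for c r
  proof (rule irreducible_double_coset[OF transversal_irreducible[OF that(2)]])
    have "c \<otimes> r = c \<otimes> r \<otimes> \<one>" using that transversal_irreducible(1) by (simp add: Units_closed)
    then show "c \<otimes> r \<in> double_coset r" unfolding double_coset_def using that(1) by blast
  qed
  obtain u where u: "u \<in> Units M" "g \<otimes> t = h \<otimes> s \<otimes> u"
    using irreducibles_meet[OF _ irr[OF g t] _ irr[OF h s] x y eq] gh tc(1) sc(1) by auto
  have "t = inv g \<otimes> (g \<otimes> t)" using unit_cancel(1)[OF g tc(1)] by simp
  also have "\<dots> = (inv g \<otimes> h) \<otimes> s \<otimes> u"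
    unfolding u(2) using g gh sc(1) u(1) by (simp add: m_assoc Units_closed)
  finally have "t \<in> double_coset s"
    unfolding double_coset_def using g h u(1) Units_m_closed Units_inv_Units by blast
  then show ts: "t = s" by (rule transversal_unique[OF t s])
  have k: "inv h \<otimes> g \<in> Units M" using g h by simp
  have "inv h \<otimes> g \<otimes> t = inv h \<otimes> (h \<otimes> (s \<otimes> u))"
    using g h gh tc(1) sc(1) u by (simp add: m_assoc Units_closed)
  then have ktu: "inv h \<otimes> g \<otimes> t = t \<otimes> u"
    using unit_cancel(1)[OF h, of "s \<otimes> u"] sc(1) u(1) ts by (simp add: Units_closed)
  show "inv h \<otimes> g \<in> stab t" unfolding stab_def using k ktu u(1) by blast
  have "h \<otimes> s \<otimes> (u \<otimes> x) = h \<otimes> s \<otimes> y"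
    using eq u gh sc(1) x by (simp add: m_assoc Units_closed)
  then have "u \<otimes> x = y"
    by (rule l_cancel) (use gh sc(1) x y u(1) in \<open>simp_all add: Units_closed\<close>)
  then show "twist t (inv h \<otimes> g) \<otimes> x = y" using twist_eq[OF tc(1) k u(1) ktu] by simp
qed

text \<open>A left factor of a unit is a unit, and \<open>t\<close> is irreducible.\<close>

lemma unit_neq_syllable:
  assumes "u \<in> Units M" "g \<in> Units M" "t \<in> transversal" "x \<in> carrier M"
  shows "u \<noteq> g \<otimes> t \<otimes> x"
proof
  assume u: "u = g \<otimes> t \<otimes> x"
  note t = transversal_irreducible[OF assms(3)]
  have "g \<otimes> t \<in> Units M"
    using divides_unit_Units[of "g \<otimes> t" u] assms t(1) u by (auto simp: Units_closed)
  then have "t \<in> Units M" using prod_unit_l[of g t] assms(2) t(1) by auto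
  then show False using t(2) by (simp add: irreducible_def)
qed

text \<open>For injectivity, two elements with the same image have the same number of syllables, and their
  first syllables agree up to an element of \<open>stab s\<close>. Moving that element across the stable letter
  makes the first syllables equal and leaves remainders with the same image.\<close>

theorem hnn_iso: "M \<cong> data.HNN"
proof -
  obtain \<phi> where hom: "\<phi> \<in> hom data.HNN M"
    and \<phi>_base: "\<And>g. g \<in> Units M \<Longrightarrow> \<phi> (data.base g) = g"
    and \<phi>_stable: "\<And>t. t \<in> transversal \<Longrightarrow> \<phi> (data.stable_letter t) = t"
    using hnn_hom by blast
  note closed = hom_in_carrier[OF hom] and mult = hom_mult[OF hom]
  have base_closed: "data.base g \<in> carrier data.HNN" if "g \<in> Units M" for g
    using data.base_closed[of g] that by (simp add: units_of_carrier)
  have \<phi>_syllable: "\<phi> (data.hnn_mult (data.hnn_mult (data.base g) (data.stable_letter t)) x) =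
      g \<otimes> t \<otimes> \<phi> x"
    if "g \<in> Units M" "t \<in> transversal" "x \<in> carrier data.HNN" for g t x
    using that mult base_closed \<phi>_base \<phi>_stable by simp
  have surj: "\<exists>x \<in> carrier data.HNN. \<phi> x = m" if "m \<in> carrier M" for m
    using that
  proof (induction rule: factorization_induct)
    case (unit u)
    then show ?case using \<phi>_base base_closed by blast
  next
    case (irreducible a)
    then obtain g t h where a: "g \<in> Units M" "t \<in> transversal" "h \<in> Units M" "a = g \<otimes> t \<otimes> h"
      using irreducible_transversal by blast
    show ?case
      by (rule bexI[of _ "data.hnn_mult (data.hnn_mult (data.base g) (data.stable_letter t))
            (data.base h)"])
        (use a \<phi>_syllable \<phi>_base base_closed in simp_all)
  next
    case (mult a b)
    then obtain x y where "x \<in> carrier data.HNN" "\<phi> x = a" "y \<in> carrier data.HNN" "\<phi> y = b"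
      by blast
    then show ?case by (intro bexI[of _ "data.hnn_mult x y"]) (simp_all add: hom_mult[OF hom])
  qed
  have inj: "x = y" if "x \<in> carrier data.HNN" "y \<in> carrier data.HNN" "\<phi> x = \<phi> y" for x y
    using that
  proof (induction arbitrary: y rule: data.HNN_induct)
    case (base g)
    then have g: "g \<in> Units M" by (simp add: units_of_carrier)
    from base.prems(1) show ?case
    proof (cases rule: data.HNN_cases)
      case h: (base h)
      then show ?thesis using g base.prems(2) \<phi>_base by (simp add: units_of_carrier)
    next
      case y: (syllable h t m)
      then have h: "h \<in> Units M" by (simp add: units_of_carrier)
      have "g = h \<otimes> t \<otimes> \<phi> m"
        using base.prems(2) \<phi>_base[OF g] \<phi>_syllable[OF h y(2,3)] y(4) by simp
      then show ?thesis using unit_neq_syllable[OF g h y(2) closed[OF y(3)]] by simp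
    qed
  next
    case (syllable g t x)
    note x = syllable.hyps
    from x(1) have g: "g \<in> Units M" by (simp add: units_of_carrier)
    from syllable.prems(1) show ?case
    proof (cases rule: data.HNN_cases)
      case y: (base h)
      then have h: "h \<in> Units M" by (simp add: units_of_carrier)
      have "h = g \<otimes> t \<otimes> \<phi> x"
        using syllable.prems(2) \<phi>_base[OF h] \<phi>_syllable[OF g x(2,3)] y(2) by simp
      then show ?thesis using unit_neq_syllable[OF h g x(2) closed[OF x(3)]] by simp
    next
      case y: (syllable h s z)
      then have h: "h \<in> Units M" by (simp add: units_of_carrier)
      have "h \<otimes> s \<otimes> \<phi> z = g \<otimes> t \<otimes> \<phi> x"
        using syllable.prems(2) \<phi>_syllable[OF g x(2,3)] \<phi>_syllable[OF h y(2,3)] y(4) by simp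
      note meet = syllables_meet[OF h g y(2) x(2) closed[OF y(3)] closed[OF x(3)] this]
      let ?k = "inv g \<otimes> h"
      have s: "s \<in> carrier M" using y(2) transversal_irreducible by blast
      have k: "inv\<^bsub>units_of M\<^esub> g \<otimes>\<^bsub>units_of M\<^esub> h = ?k"
        using g by (simp add: units_of_inv units_of_mult)
      have u: "twist s ?k \<in> Units M" using stab_twist(2)[OF s meet(2)] .
      have "\<phi> x = \<phi> (data.hnn_mult (data.base (twist s ?k)) z)"
        using mult[OF base_closed[OF u] y(3)] \<phi>_base[OF u] meet(3) by simp
      then have "x = data.hnn_mult (data.base (twist s ?k)) z"
        using syllable.IH data.HNN.m_closed[OF base_closed[OF u] y(3)] by simp
      then show ?thesis
        using data.syllable_change_coset[OF y(1) x(1) y(2,3), unfolded k, OF meet(2)] y(4) meet(1)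
        by simp
    qed
  qed
  have bij: "bij_betw \<phi> (carrier data.HNN) (carrier M)"
    unfolding bij_betw_def inj_on_def using inj surj closed by blast
  define \<psi> where "\<psi> = inv_into (carrier data.HNN) \<phi>"
  have \<psi>: "\<psi> m \<in> carrier data.HNN" "\<phi> (\<psi> m) = m" if "m \<in> carrier M" for m
    using that bij unfolding \<psi>_def bij_betw_def
    by (auto intro: inv_into_into f_inv_into_f)
  have "\<psi> \<in> hom M data.HNN"
  proof (rule homI)
    fix a b assume ab: "a \<in> carrier M" "b \<in> carrier M"
    show "\<psi> (a \<otimes> b) = data.hnn_mult (\<psi> a) (\<psi> b)"
      by (rule inj) (use ab \<psi> mult in simp_all)
  qed (use \<psi> in simp)
  moreover have "bij_betw \<psi> (carrier M) (carrier data.HNN)"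
    unfolding \<psi>_def using bij by (rule bij_betw_inv_into)
  ultimately show ?thesis by (intro is_isoI isoI)
qed

end

lemma left_rees_if_left_rees_monoid:
  assumes "left_rees_monoid M"
  shows "left_rees M"
proof -
  have "monoid M" using assms by (simp add: left_rees_monoid_def)
  then interpret monoid M .
  show ?thesis
    by (intro left_rees.intro left_rees_axioms.intro)
      (use assms[unfolded left_rees_monoid_iff] monoid_axioms in blast)+
qed

theorem theorem2p3p1:
  fixes G :: "('g, 'm) monoid_scheme" and I :: "'i set"
    and H :: "'i \<Rightarrow> 'g set" and \<rho> :: "'i \<Rightarrow> 'g \<Rightarrow> 'g"
    and M :: "('a, 'n) monoid_scheme"
  shows
    "(group G \<and> monoid_hnn_data G I H \<rho> \<and> (\<forall>i\<in>I. subgroup (H i) G)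
        \<longrightarrow> left_rees_monoid (hnn_extension G I H \<rho>)) \<and>
     (left_rees_monoid M
        \<longrightarrow> (\<exists>(G' :: 'a monoid) (J :: 'a set) (K :: 'a \<Rightarrow> 'a set) (\<sigma> :: 'a \<Rightarrow> 'a \<Rightarrow> 'a).
              group G' \<and> monoid_hnn_data G' J K \<sigma> \<and> M \<cong> hnn_extension G' J K \<sigma>))"
proof (intro conjI impI)
  assume "group G \<and> monoid_hnn_data G I H \<rho> \<and> (\<forall>i\<in>I. subgroup (H i) G)"
  then have "group_hnn_data G I H \<rho>"
    by (simp add: group_hnn_data_def group_hnn_data_axioms_def)
  then show "left_rees_monoid (hnn_extension G I H \<rho>)"
    by (rule group_hnn_data.left_rees_HNN)
next
  assume "left_rees_monoid M"
  then interpret left_rees M by (rule left_rees_if_left_rees_monoid)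
  show "\<exists>(G' :: 'a monoid) (J :: 'a set) (K :: 'a \<Rightarrow> 'a set) (\<sigma> :: 'a \<Rightarrow> 'a \<Rightarrow> 'a).
      group G' \<and> monoid_hnn_data G' J K \<sigma> \<and> M \<cong> hnn_extension G' J K \<sigma>"
    using units_group data.monoid_hnn_data_axioms hnn_iso by blast
qed

end
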